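(* Let $\widehat E=E+\varepsilon E_0$ and $\widehat F=F+\varepsilon F_0$ be dual matrices in $\mathbb{D}^{m\times n}$ whose dual Moore-Penrose generalized inverses (DMPGIs) exist. Then $\widehat E\overset{{\rm DM}\text{-}\ast}{\leq}\widehat F$ (Dual-minus star partial order) if and only if $\widehat E\overset{\rm D}{\leq}\widehat F$ (Dual-minus partial order) and $$EF^{T}=(EF^{T})^{T},\qquad F^{T}E=(F^{T}E)^{T}.$$
   Context: $\varepsilon$ is the dual unit: $\varepsilon\neq 0$, $\varepsilon^2=0$, commuting with reals. $\mathbb{D}^{m\times n}$ is the set of $m\times n$ dual matrices $\widehat E=E+\varepsilon E_0$ with $E,E_0\in\mathbb{R}^{m\times n}$, with the obvious addition, multiplication and transpose $\widehat E^{T}=E^T+\varepsilon E_0^T$. The DMPGI of $\widehat E\in\mathbb{D}^{m\times n}$ is the unique $\widehat X\in\mathbb{D}^{n\times m}$, if it exists, with $\widehat E\widehat X\widehat E=\widehat E$, $\widehat X\widehat E\widehat X=\widehat X$, $(\widehat E\widehat X)^T=\widehat E\widehat X$, $(\widehat X\widehat E)^T=\widehat X\widehat E$. Minus partial order on real matrices of the same size: $E\leq F$ means $\mathrm{rk}(F-E)=\mathrm{rk}(F)-\mathrm{rk}(E)$. Star partial order: $E\overset{\ast}{\leq}F$ means $E^{T}E=E^{T}F$ and $EE^{T}=FE^{T}$. For $\widehat E,\widehat F\in\mathbb{D}^{m\times n}$ whose DMPGIs exist: (i) Dual-minus partial order: $\widehat E\overset{\rm D}{\leq}\widehat F$ means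 that $E\leq F$ and the DMPGI of $\widehat F-\widehat E$ exists. (ii) Dual-minus star partial order: $\widehat E\overset{{\rm DM}\text{-}\ast}{\leq}\widehat F$ means that $E\overset{\ast}{\leq}F$ and the DMPGI of $\widehat F-\widehat E$ exists. *)

theory Defs
  imports "HOL-Analysis.Analysis"
begin

text \<open>Dual numbers: \<open>Dual a b\<close> is \<open>a + \<epsilon> b\<close>.\<close>

datatype dual = Dual (std: real) (inf_part: real)

instantiation dual :: comm_ring_1
begin

definition zero_dual :: dual where "0 = Dual 0 0"
definition one_dual :: dual where "1 = Dual 1 0"
definition plus_dual :: "dual \<Rightarrow> dual \<Rightarrow> dual" where
  "x + y = Dual (std x + std y) (inf_part x + inf_part y)"
definition uminus_dual :: "dual \<Rightarrow> dual" where
  "- x = Dual (- std x) (- inf_part x)"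
definition minus_dual :: "dual \<Rightarrow> dual \<Rightarrow> dual" where
  "x - y = Dual (std x - std y) (inf_part x - inf_part y)"
definition times_dual :: "dual \<Rightarrow> dual \<Rightarrow> dual" where
  "x * y = Dual (std x * std y) (std x * inf_part y + inf_part x * std y)"

instance
  by standard
    (auto simp: zero_dual_def one_dual_def plus_dual_def uminus_dual_def
      minus_dual_def times_dual_def algebra_simps intro!: dual.expand)

end

definition dual_unit :: dual where "dual_unit = Dual 0 1"

lemma dual_unit_nonzero: "dual_unit \<noteq> 0"
  by (simp add: dual_unit_def zero_dual_def)

lemma dual_unit_square: "dual_unit\<^sup>2 = 0"
  by (simp add: dual_unit_def zero_dual_def times_dual_def power2_eq_square)

lemma Dual_eq: "Dual a b = Dual a 0 + dual_unit * Dual b 0"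
  by (simp add: dual_unit_def plus_dual_def times_dual_def)

text \<open>
  The \<open>m\<close> by \<open>n\<close> dual matrices are the library matrices over \<^typ>\<open>dual\<close>;
  \<open>dual_mat E E0\<close> is \<open>E + \<epsilon> E0\<close>.
\<close>

definition dual_mat :: "real^'n^'m \<Rightarrow> real^'n^'m \<Rightarrow> dual^'n^'m" where
  "dual_mat E E0 = (\<chi> i j. Dual (E $ i $ j) (E0 $ i $ j))"

definition std_mat :: "dual^'n^'m \<Rightarrow> real^'n^'m" where
  "std_mat A = (\<chi> i j. std (A $ i $ j))"

definition inf_mat :: "dual^'n^'m \<Rightarrow> real^'n^'m" where
  "inf_mat A = (\<chi> i j. inf_part (A $ i $ j))"

lemma std_mat_dual_mat [simp]: "std_mat (dual_mat E E0) = E"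
  and inf_mat_dual_mat [simp]: "inf_mat (dual_mat E E0) = E0"
  and dual_mat_std_inf [simp]: "dual_mat (std_mat A) (inf_mat A) = A"
  by (simp_all add: std_mat_def inf_mat_def dual_mat_def vec_eq_iff)

definition is_DMPGI :: "dual^'n^'m \<Rightarrow> dual^'m^'n \<Rightarrow> bool" where
  "is_DMPGI A X \<longleftrightarrow>
     A ** X ** A = A \<and> X ** A ** X = X \<and>
     transpose (A ** X) = A ** X \<and> transpose (X ** A) = X ** A"

lemma is_DMPGI_unique:
  assumes "is_DMPGI A X" and "is_DMPGI A Y"
  shows "X = Y"
proof -
  note X = assms(1)[unfolded is_DMPGI_def] and Y = assms(2)[unfolded is_DMPGI_def]
  have AX: "A ** X = A ** Y"
  proof -
    have "A ** X = transpose ((A ** Y) ** (A ** X))"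
      using X Y by (metis matrix_mul_assoc)
    also have "\<dots> = (A ** X) ** (A ** Y)"
      using X Y by (simp add: matrix_transpose_mul)
    also have "\<dots> = A ** Y"
      using X by (metis matrix_mul_assoc)
    finally show ?thesis .
  qed
  have XA: "X ** A = Y ** A"
  proof -
    have "X ** A = transpose ((X ** A) ** (Y ** A))"
      using X Y by (metis matrix_mul_assoc)
    also have "\<dots> = (Y ** A) ** (X ** A)"
      using X Y by (simp add: matrix_transpose_mul)
    also have "\<dots> = Y ** A"
      using X by (metis matrix_mul_assoc)
    finally show ?thesis .
  qed
  have "X = X ** A ** X" using X by simp
  also have "\<dots> = Y ** (A ** X)" by (simp add: XA matrix_mul_assoc)
  also have "\<dots> = Y" using Y by (simp add: AX matrix_mul_assoc)
  finally show ?thesis .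
qed

definition has_DMPGI :: "dual^'n^'m \<Rightarrow> bool" where
  "has_DMPGI A \<longleftrightarrow> (\<exists>X. is_DMPGI A X)"

text \<open>The rank difference is taken in the integers, since subtraction on \<^typ>\<open>nat\<close> truncates.\<close>

definition minus_le :: "real^'n^'m \<Rightarrow> real^'n^'m \<Rightarrow> bool" where
  "minus_le E F \<longleftrightarrow> int (rank (F - E)) = int (rank F) - int (rank E)"

definition star_le :: "real^'n^'m \<Rightarrow> real^'n^'m \<Rightarrow> bool" where
  "star_le E F \<longleftrightarrow>
     transpose E ** E = transpose E ** F \<and> E ** transpose E = F ** transpose E"

text \<open>Both dual orders relate only dual matrices that have a DMPGI.\<close>

definition dual_minus_le :: "dual^'n^'m \<Rightarrow> dual^'n^'m \<Rightarrow> bool" where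
  "dual_minus_le A B \<longleftrightarrow>
     has_DMPGI A \<and> has_DMPGI B \<and> minus_le (std_mat A) (std_mat B) \<and> has_DMPGI (B - A)"

definition dual_minus_star_le :: "dual^'n^'m \<Rightarrow> dual^'n^'m \<Rightarrow> bool" where
  "dual_minus_star_le A B \<longleftrightarrow>
     has_DMPGI A \<and> has_DMPGI B \<and> star_le (std_mat A) (std_mat B) \<and> has_DMPGI (B - A)"

end

theory Submission
  imports Defs
begin

text \<open>Put \<open>G = F - E\<close>. Only the standard parts matter: the star order says \<open>E\<^sup>T G = 0\<close> and
  \<open>G E\<^sup>T = 0\<close>, the minus order says that the rank of \<open>E + G\<close> is additive, and additivity of
  rank makes the column spaces of \<open>E\<close> and \<open>G\<close>, and likewise their row spaces, meet trivially.
  The symmetry conditions read \<open>E G\<^sup>T = G E\<^sup>T\<close> and \<open>E\<^sup>T G = G\<^sup>T E\<close>; in each of them the two sides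
  have their columns in spaces that meet trivially, so they vanish.\<close>

lemma matrix_add_rdistrib: "(A + B) ** C = A ** C + B ** C"
  by (simp add: matrix_matrix_mult_def vec_eq_iff distrib_right sum.distrib)

lemma transpose_zero: "transpose 0 = 0"
  by (simp add: transpose_def vec_eq_iff)

lemma transpose_add: "transpose (A + B) = transpose A + transpose B"
  by (simp add: transpose_def vec_eq_iff)

lemma range_matrix_sum_subset:
  fixes A B :: "real^'n^'m"
  shows "range ((*v) (A + B)) \<subseteq> {x + y |x y. x \<in> range ((*v) A) \<and> y \<in> range ((*v) B)}"
  by (auto simp: matrix_vector_mult_add_rdistrib)

text \<open>Grassmann's dimension formula, applied to the two column spaces.\<close>

lemma dim_range_sum_Int:
  fixes A B :: "real^'n^'m"
  shows "dim {x + y |x y. x \<in> range ((*v) A) \<and> y \<in> range ((*v) B)}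
    + dim (range ((*v) A) \<inter> range ((*v) B)) = rank A + rank B"
  by (simp add: rank_dim_range dim_sums_Int linear_subspace_image)

text \<open>The columns of \<open>A + B\<close> lie in the sum of the two column spaces, so
  \<open>rank (A + B)\<close> is at most \<open>rank A + rank B\<close> minus the dimension of their
  intersection; additivity forces that dimension to be 0.\<close>

lemma rank_add_imp_range_Int_trivial:
  fixes A B :: "real^'n^'m"
  assumes "rank (A + B) = rank A + rank B"
  shows "range ((*v) A) \<inter> range ((*v) B) \<subseteq> {0}"
proof -
  have "rank (A + B) \<le> dim {x + y |x y. x \<in> range ((*v) A) \<and> y \<in> range ((*v) B)}"
    unfolding rank_dim_range by (rule dim_subset[OF range_matrix_sum_subset])
  then have "dim (range ((*v) A) \<inter> range ((*v) B)) = 0"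
    using dim_range_sum_Int[of A B] assms by linarith
  then show ?thesis
    by (simp only: dim_eq_0)
qed

lemma matrix_mul_eq_zero_of_range_Int_trivial:
  fixes A B :: "real^'n^'m" and C D :: "real^'k^'n"
  assumes int: "range ((*v) A) \<inter> range ((*v) B) \<subseteq> {0}" and eq: "A ** C = B ** D"
  shows "B ** D = 0"
proof -
  have "(B ** D) *v x = 0 *v x" for x
  proof -
    have "(B ** D) *v x = A *v (C *v x)" "(B ** D) *v x = B *v (D *v x)"
      by (simp_all add: matrix_vector_mul_assoc eq)
    then have "(B ** D) *v x \<in> range ((*v) A) \<inter> range ((*v) B)"
      by (metis IntI rangeI)
    then show ?thesis using int by auto
  qed
  then show ?thesis
    using matrix_eq by blast
qed

text \<open>Only the component of a vector in the row space of \<open>A\<close> contributes to its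
  image under \<open>A\<close>, and that component has the form
  \<open>transpose A *v u\<close>.\<close>

lemma range_matrix_mul_transpose:
  fixes A :: "real^'n^'m"
  shows "range ((*v) (A ** transpose A)) = range ((*v) A)"
proof
  show "range ((*v) (A ** transpose A)) \<subseteq> range ((*v) A)"
    by (auto simp: matrix_vector_mul_assoc[symmetric])
  show "range ((*v) A) \<subseteq> range ((*v) (A ** transpose A))"
  proof
    fix y assume "y \<in> range ((*v) A)"
    then obtain x where y: "y = A *v x" by auto
    let ?S = "range ((*v) (transpose A))"
    have span: "span ?S = ?S"
      by (simp add: linear_subspace_image span_eq_iff del: transpose_matrix_vector)
    obtain p q where pq: "p \<in> span ?S" "\<And>w. w \<in> span ?S \<Longrightarrow> orthogonal q w" "x = p + q"
      using orthogonal_subspace_decomp_exists by metis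
    obtain u where u: "p = transpose A *v u"
      using pq(1) unfolding span by blast
    \<comment> \<open>Orthogonality of \<open>q\<close> to the row space makes the squared norm of
      \<open>A *v q\<close> vanish.\<close>
    have "(A *v q) \<bullet> (A *v q) = q \<bullet> (transpose A *v (A *v q))"
      by (simp add: dot_lmul_matrix[symmetric] inner_commute)
    also have "\<dots> = 0"
      using pq(2) unfolding span orthogonal_def by auto
    finally have "A *v q = 0" by simp
    then have "y = (A ** transpose A) *v u"
      by (simp add: y pq(3) u matrix_vector_right_distrib matrix_vector_mul_assoc del: transpose_matrix_vector)
    then show "y \<in> range ((*v) (A ** transpose A))" by simp
  qed
qed

text \<open>\<open>BA\<close> places both column spaces inside that of \<open>A + B\<close>, which
  is therefore their sum; \<open>AB\<close> makes them orthogonal, so the sum is direct.\<close>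

lemma rank_add_of_orthogonal:
  fixes A B :: "real^'n^'m"
  assumes AB: "transpose A ** B = 0" and BA: "B ** transpose A = 0"
  shows "rank (A + B) = rank A + rank B"
proof -
  let ?R = "range ((*v) (A + B))"
  have AB': "A ** transpose B = 0"
    using arg_cong[OF BA, of transpose] by (simp add: matrix_transpose_mul transpose_zero)
  \<comment> \<open>Multiplying by one transpose annihilates the other summand, which exhibits each
    Gram matrix as a right multiple of \<open>A + B\<close>.\<close>
  have "A ** transpose A = (A + B) ** transpose A" "B ** transpose B = (A + B) ** transpose B"
    by (simp_all add: matrix_add_rdistrib BA AB')
  then have sub: "range ((*v) A) \<subseteq> ?R" "range ((*v) B) \<subseteq> ?R"
    unfolding range_matrix_mul_transpose[of A, symmetric] range_matrix_mul_transpose[of B, symmetric]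
    by (auto simp: matrix_vector_mul_assoc[symmetric])
  have "subspace ?R"
    by (simp add: linear_subspace_image)
  then have "{x + y |x y. x \<in> range ((*v) A) \<and> y \<in> range ((*v) B)} \<subseteq> ?R"
    using sub by (auto intro!: subspace_add)
  then have *: "{x + y |x y. x \<in> range ((*v) A) \<and> y \<in> range ((*v) B)} = ?R"
    using range_matrix_sum_subset[of A B] by blast
  have "x = 0" if "x = A *v a" "x = B *v b" for x a b
  proof -
    have "x \<bullet> x = a \<bullet> (transpose A *v (B *v b))"
      using that by (metis dot_lmul_matrix inner_commute transpose_matrix_vector transpose_transpose)
    then show ?thesis
      by (simp add: matrix_vector_mul_assoc AB)
  qed
  then have "range ((*v) A) \<inter> range ((*v) B) \<subseteq> {0}" by blast
  then have "dim (range ((*v) A) \<inter> range ((*v) B)) = 0"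
    by (simp only: dim_eq_0)
  then show ?thesis
    using dim_range_sum_Int[of A B] unfolding * rank_dim_range by linarith
qed

lemma star_le_iff_orthogonal:
  "star_le E F \<longleftrightarrow> transpose E ** (F - E) = 0 \<and> (F - E) ** transpose E = 0"
proof -
  have "transpose E ** (F - E) = transpose E ** F - transpose E ** E"
    "(F - E) ** transpose E = F ** transpose E - E ** transpose E"
    by (simp_all add: matrix_matrix_mult_def vec_eq_iff algebra_simps sum_subtractf)
  then show ?thesis
    unfolding star_le_def by auto
qed

lemma minus_le_iff_rank_add:
  "minus_le E F \<longleftrightarrow> rank (E + (F - E)) = rank E + rank (F - E)"
  unfolding minus_le_def by auto

lemma star_le_iff_minus_le:
  fixes E F :: "real^'n^'m"
  shows "star_le E F \<longleftrightarrow> minus_le E F \<and>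
    E ** transpose F = transpose (E ** transpose F) \<and>
    transpose F ** E = transpose (transpose F ** E)"
proof
  assume star: "star_le E F"
  then have "minus_le E F"
    unfolding star_le_iff_orthogonal minus_le_iff_rank_add by (blast intro: rank_add_of_orthogonal)
  \<comment> \<open>The star order turns both products into Gram matrices of \<open>E\<close>, which
    are symmetric.\<close>
  moreover have "transpose (E ** transpose F) = E ** transpose E"
    "transpose (transpose F ** E) = transpose E ** E"
    using star by (simp_all add: star_le_def matrix_transpose_mul)
  ultimately show "minus_le E F \<and> E ** transpose F = transpose (E ** transpose F) \<and>
    transpose F ** E = transpose (transpose F ** E)"
    by (metis matrix_transpose_mul transpose_transpose)
next
  assume R: "minus_le E F \<and> E ** transpose F = transpose (E ** transpose F) \<and>
    transpose F ** E = transpose (transpose F ** E)"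
  define G where "G = F - E"
  have F: "F = E + G" by (simp add: G_def)
  have rk: "rank (E + G) = rank E + rank G"
    using R by (simp add: minus_le_iff_rank_add G_def)
  \<comment> \<open>Row spaces are treated as column spaces of the transposes.\<close>
  then have rkT: "rank (transpose E + transpose G) = rank (transpose E) + rank (transpose G)"
    by (simp add: rank_transpose flip: transpose_add)
  \<comment> \<open>After expanding \<open>F\<close>, the symmetric terms
    \<open>E ** transpose E\<close> and \<open>transpose E ** E\<close> cancel.\<close>
  have "E ** transpose G = G ** transpose E" "transpose E ** G = transpose G ** E"
    using R by (simp_all add: F matrix_transpose_mul transpose_add matrix_add_ldistrib matrix_add_rdistrib)
  \<comment> \<open>The third equation is kept in order to pass from
    \<open>transpose G ** E = 0\<close> to \<open>transpose E ** G = 0\<close>.\<close>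
  then have "G ** transpose E = 0" "transpose G ** E = 0" "transpose E ** G = transpose G ** E"
    using matrix_mul_eq_zero_of_range_Int_trivial rank_add_imp_range_Int_trivial[OF rk]
      rank_add_imp_range_Int_trivial[OF rkT] by blast+
  then show "star_le E F"
    by (simp add: star_le_iff_orthogonal G_def)
qed

theorem theorem5p4:
  fixes E E0 F F0 :: "real^'n^'m"
  assumes "has_DMPGI (dual_mat E E0)"
    and "has_DMPGI (dual_mat F F0)"
  shows "dual_minus_star_le (dual_mat E E0) (dual_mat F F0) \<longleftrightarrow>
    dual_minus_le (dual_mat E E0) (dual_mat F F0) \<and>
    E ** transpose F = transpose (E ** transpose F) \<and>
    transpose F ** E = transpose (transpose F ** E)"
  \<comment> \<open>The \<open>has_DMPGI\<close> conjuncts agree on both sides, so the claim reduces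
    to the real matrices \<open>E\<close> and \<open>F\<close>.\<close>
  unfolding dual_minus_star_le_def dual_minus_le_def std_mat_dual_mat
  using star_le_iff_minus_le[of E F] by blast

end
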